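(* Let $r\ge 3$ and $m\le n$ be positive integers. Let $G$ be any $n$-vertex graph and let $M\subset V(G)$ be a set of $m$ vertices. If no copy of $K_r$ in $G$ intersects $M$, then $e(G)\le t_r(n,m)$, where \[ t_r(n,m):=\begin{cases} t_r(n) & \text{if } n\le (r-1)m,\\ \binom{n}{2}-nm+(r-1)\binom{m+1}{2} & \text{otherwise.}\end{cases} \] Moreover, if $n\le (r-1)m$ and $e(G)=t_r(n,m)$, then $G$ is isomorphic to $T_r(n)$.
   Context: $T_r(n)$ denotes the Turán graph, i.e. the complete balanced $(r-1)$-partite graph on $n$ vertices (part sizes as equal as possible), and $t_r(n)$ denotes its number of edges. $e(G)$ is the number of edges of $G$. *)

theory Defs
  imports Complex_Main
begin

record 'a graph =
  verts :: "'a set"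
  edges :: "'a set set"

definition finite_simple_graph :: "'a graph \<Rightarrow> bool" where
  "finite_simple_graph G \<longleftrightarrow>
     finite (verts G) \<and> (\<forall>e\<in>edges G. e \<subseteq> verts G \<and> card e = 2)"

definition num_edges :: "'a graph \<Rightarrow> nat" where
  "num_edges G = card (edges G)"

definition graph_iso :: "'a graph \<Rightarrow> 'b graph \<Rightarrow> bool" where
  "graph_iso G H \<longleftrightarrow>
     (\<exists>f. bij_betw f (verts G) (verts H) \<and>
          (\<forall>u\<in>verts G. \<forall>v\<in>verts G. {u, v} \<in> edges G \<longleftrightarrow> {f u, f v} \<in> edges H))"

definition subgraph :: "'a graph \<Rightarrow> 'a graph \<Rightarrow> bool" where
  "subgraph H G \<longleftrightarrow>
     finite_simple_graph H \<and> verts H \<subseteq> verts G \<and> edges H \<subseteq> edges G"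

definition complete_graph :: "nat \<Rightarrow> nat graph" where
  "complete_graph r = \<lparr>verts = {..<r}, edges = {{u, v} |u v. u < r \<and> v < r \<and> u \<noteq> v}\<rparr>"

definition copy_of_complete_graph :: "nat \<Rightarrow> 'a graph \<Rightarrow> 'a graph \<Rightarrow> bool" where
  "copy_of_complete_graph r G H \<longleftrightarrow> subgraph H G \<and> graph_iso H (complete_graph r)"

definition complete_multipartite :: "'i set \<Rightarrow> ('i \<Rightarrow> 'a set) \<Rightarrow> 'a graph" where
  "complete_multipartite I P =
     \<lparr>verts = (\<Union>i\<in>I. P i),
      edges = {{u, v} |u v. \<exists>i\<in>I. \<exists>j\<in>I. i \<noteq> j \<and> u \<in> P i \<and> v \<in> P j}\<rparr>"

definition turan_part :: "nat \<Rightarrow> nat \<Rightarrow> nat \<Rightarrow> nat set" where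
  "turan_part r n i = {u. u < n \<and> u mod (r - 1) = i}"

text \<open>The index \<open>r\<close> refers to the forbidden clique, so there are \<open>r - 1\<close> parts: the residue
  classes modulo \<open>r - 1\<close> on \<open>{0, \<dots>, n - 1}\<close>. Some parts are empty if \<open>n < r - 1\<close>.\<close>

definition turan_graph :: "nat \<Rightarrow> nat \<Rightarrow> nat graph" where
  "turan_graph r n = complete_multipartite {..<r - 1} (turan_part r n)"

lemma verts_turan_graph:
  assumes "r \<ge> 2"
  shows "verts (turan_graph r n) = {..<n}"
  using assms by (auto simp: turan_graph_def complete_multipartite_def turan_part_def)

lemma turan_parts_disjoint: "i \<noteq> j \<Longrightarrow> turan_part r n i \<inter> turan_part r n j = {}"
  by (auto simp: turan_part_def)

lemma turan_parts_balanced: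
  assumes "i < r - 1" "j < r - 1"
  shows "card (turan_part r n i) \<le> card (turan_part r n j) + 1"
proof -
  define k where "k = r - 1"
  have k: "i < k" "j < k" "k > 0" using assms by (auto simp: k_def)
  \<comment> \<open>Shifting a non-minimal element of part \<open>i\<close> down by \<open>k + i - j\<close> lands in part \<open>j\<close>.\<close>
  let ?f = "\<lambda>u. u - (k + i - j)"
  have fin: "finite (turan_part r n l)" for l by (simp add: turan_part_def)
  have shape: "\<exists>q. u = k + i + q * k" if "u \<in> turan_part r n i - {i}" for u
  proof -
    have "u mod k = i" "u \<noteq> i" using that by (auto simp: turan_part_def k_def)
    then have e: "u = u div k * k + i" and "u div k \<noteq> 0"
      by (metis div_mult_mod_eq) (use \<open>u mod k = i\<close> \<open>u \<noteq> i\<close> in \<open>metis add_0 div_mult_mod_eq mult_0\<close>)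
    then obtain q where "u div k = Suc q" by (cases "u div k") auto
    then show ?thesis using e by (intro exI[of _ q]) simp
  qed
  have inj: "inj_on ?f (turan_part r n i - {i})"
  proof (rule inj_onI)
    fix x y assume x: "x \<in> turan_part r n i - {i}" and y: "y \<in> turan_part r n i - {i}"
      and xy: "?f x = ?f y"
    from shape[OF x] obtain p where "x = k + i + p * k" by blast
    moreover from shape[OF y] obtain q where "y = k + i + q * k" by blast
    ultimately show "x = y" using xy k by simp
  qed
  have sub: "?f ` (turan_part r n i - {i}) \<subseteq> turan_part r n j"
  proof
    fix w assume "w \<in> ?f ` (turan_part r n i - {i})"
    then obtain u where u: "u \<in> turan_part r n i - {i}" and w: "w = ?f u" by blast
    from shape[OF u] obtain q where q: "u = k + i + q * k" by blast
    have "w = j + q * k" using w q k by simp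
    moreover have "w < n" using w u by (auto simp: turan_part_def)
    ultimately show "w \<in> turan_part r n j" using k by (simp add: turan_part_def k_def)
  qed
  have "card (turan_part r n i) \<le> card (turan_part r n i - {i}) + 1"
    by (metis One_nat_def add.commute card_Diff_singleton_if diff_le_self le_diff_conv
        order_refl le_add1 plus_1_eq_Suc)
  also have "card (turan_part r n i - {i}) \<le> card (turan_part r n j)"
    using card_inj_on_le[OF inj sub fin] .
  finally show ?thesis by simp
qed

definition turan_number :: "nat \<Rightarrow> nat \<Rightarrow> nat" where
  "turan_number r n = num_edges (turan_graph r n)"

text \<open>Integer-valued, so that the subtraction is not truncated.\<close>

definition turan_bound :: "nat \<Rightarrow> nat \<Rightarrow> nat \<Rightarrow> int" where
  "turan_bound r n m =
     (if n \<le> (r - 1) * m then int (turan_number r n)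
      else int (n choose 2) - int n * int m + (int r - 1) * int ((m + 1) choose 2))"

end

theory Submission
  imports Defs "HOL-Combinatorics.Transposition"
begin

text \<open>Let \<open>k = r - 1\<close>. If every vertex outside \<open>M\<close> has fewer than \<open>p\<close> non-neighbours and
  \<open>card M \<le> p + 1\<close>, then a clique through \<open>v \<in> M\<close> can be extended greedily outside \<open>M\<close>, so
  \<open>v\<close> has degree at most \<open>(k - 1) * p\<close>. With \<open>p = m\<close> and \<open>n > k * m\<close> this always yields a vertex that
  can be deleted (from \<open>M\<close> or from its complement), and induction gives the bound
  \<open>2 e \<le> n (n - 1) - 2 n m + k m (m + 1)\<close>. Taking a subset of \<open>M\<close> of size \<open>p\<close> with
  \<open>k * p \<le> n \<le> k * (p + 1)\<close> turns it into the Turan bound.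

  For the equality case, choose \<open>p = (n - 1) div k\<close> and shrink \<open>M\<close> to size \<open>p + 1\<close>. The same
  alternative gives a vertex \<open>x\<close> with exactly \<open>p\<close> non-neighbours whose deletion leaves a Turan graph.
  Since no \<open>(k + 1)\<close>-clique through \<open>x\<close> meets \<open>M\<close>, the vertex \<open>x\<close> misses an entire part, which has
  size \<open>p\<close> and hence is a smallest part; adding \<open>x\<close> to it gives the Turan graph again.\<close>

section \<open>Edge counts and cliques on a varying vertex set\<close>

definition induced_edges :: "'a set set \<Rightarrow> 'a set \<Rightarrow> 'a set set" where
  "induced_edges E V = {e \<in> E. e \<subseteq> V}"

definition neighbours :: "'a set set \<Rightarrow> 'a set \<Rightarrow> 'a \<Rightarrow> 'a set" where
  "neighbours E V v = {u \<in> V. {u, v} \<in> E}"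

definition clique :: "'a set set \<Rightarrow> 'a set \<Rightarrow> bool" where
  "clique E C \<longleftrightarrow> (\<forall>u\<in>C. \<forall>v\<in>C. u \<noteq> v \<longrightarrow> {u, v} \<in> E)"

text \<open>Cliques are plain vertex sets here, so that \<open>V\<close> and \<open>M\<close> can
  shrink in the inductions while the edge set \<open>E\<close> stays fixed.\<close>

definition cliques_avoid :: "nat \<Rightarrow> 'a set set \<Rightarrow> 'a set \<Rightarrow> 'a set \<Rightarrow> bool" where
  "cliques_avoid r E V M \<longleftrightarrow> (\<forall>C\<subseteq>V. clique E C \<and> card C = r \<longrightarrow> C \<inter> M = {})"

lemma cliques_avoid_mono:
  assumes "cliques_avoid r E V M" "V' \<subseteq> V" "M' \<subseteq> M"
  shows "cliques_avoid r E V' M'"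
  unfolding cliques_avoid_def
proof (intro allI impI)
  fix C assume "C \<subseteq> V'" "clique E C \<and> card C = r"
  moreover from this have "C \<subseteq> V" using assms(2) by blast
  ultimately have "C \<inter> M = {}" using assms(1) unfolding cliques_avoid_def by simp
  then show "C \<inter> M' = {}" using assms(3) by blast
qed

lemma clique_insert:
  "clique E C \<Longrightarrow> (\<And>c. c \<in> C \<Longrightarrow> {w, c} \<in> E) \<Longrightarrow> clique E (insert w C)"
  unfolding clique_def by (metis insert_commute insert_iff)

lemma neighbours_subset: "neighbours E V v \<subseteq> V"
  by (auto simp: neighbours_def)

lemma not_self_neighbour:
  assumes "\<forall>e\<in>E. card e = 2"
  shows "v \<notin> neighbours E V v"
  using assms by (force simp: neighbours_def)

lemma card_induced_edges_remove:
  assumes "finite V" "\<forall>e\<in>E. card e = 2" "v \<in> V"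
  shows "card (induced_edges E V) =
    card (induced_edges E (V - {v})) + card (neighbours E V v)"
proof -
  have "induced_edges E V =
      induced_edges E (V - {v}) \<union> (\<lambda>u. {u, v}) ` neighbours E V v" (is "_ = ?A \<union> ?B")
  proof (intro subset_antisym subsetI)
    fix e assume e: "e \<in> induced_edges E V"
    show "e \<in> ?A \<union> ?B"
    proof (cases "v \<in> e")
      case True
      from e assms(2) have "card e = 2" by (auto simp: induced_edges_def)
      then obtain a b where "e = {a, b}" by (auto simp: card_2_iff)
      with True obtain u where "e = {u, v}" by auto
      with e show ?thesis by (auto simp: induced_edges_def neighbours_def)
    qed (use e in \<open>auto simp: induced_edges_def\<close>)
  qed (use assms(3) in \<open>auto simp: induced_edges_def neighbours_def\<close>)
  moreover have "?A \<inter> ?B = {}" by (auto simp: induced_edges_def)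
  moreover have "finite ?A"
    using assms(1) by (intro finite_subset[of ?A "Pow V"]) (auto simp: induced_edges_def)
  moreover have "finite ?B" using assms(1) by (simp add: neighbours_def)
  moreover have "card ?B = card (neighbours E V v)"
    by (rule card_image) (auto simp: inj_on_def doubleton_eq_iff)
  ultimately show ?thesis by (simp add: card_Un_disjoint)
qed

section \<open>Greedy clique extension and the general edge bound\<close>

text \<open>Otherwise \<open>v\<close> has more than \<open>(k - 1) * p\<close> neighbours. Each
  clique vertex added outside \<open>M\<close> removes at most \<open>p\<close> common neighbours,
  so after \<open>k - 1\<close> additions one is still left and completes a clique of size
  \<open>Suc k\<close> through \<open>v\<close>.\<close>

lemma card_neighbours_le_of_cliques_avoid:
  assumes fin: "finite V" and E: "\<forall>e\<in>E. card e = 2" and "M \<subseteq> V"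
    and avoid: "cliques_avoid (Suc k) E V M" and "k > 0"
    and nonnb: "\<And>w. w \<in> V - M \<Longrightarrow> card (V - neighbours E V w) \<le> p"
    and "card M \<le> Suc p" and "v \<in> M"
  shows "card (neighbours E V v) \<le> (k - 1) * p"
proof (rule ccontr)
  assume large: "\<not> ?thesis"
  define common where "common C = {u \<in> V. \<forall>c\<in>C. {u, c} \<in> E}" for C
  have common_sub: "common C \<subseteq> V" for C by (auto simp: common_def)
  have common_disj: "C \<inter> common C = {}" for C using E by (force simp: common_def)
  have fin_common: "finite (common C)" for C using common_sub fin by (rule finite_subset)
  have step: "\<exists>C\<subseteq>V. clique E C \<and> v \<in> C \<and> card C = Suc j \<and> (k - 1 - j) * p < card (common C)"
    if "j \<le> k - 1" for j
    using that
  proof (induction j)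
    case 0
    show ?case
      using large \<open>v \<in> M\<close> \<open>M \<subseteq> V\<close>
      by (intro exI[of _ "{v}"]) (auto simp: clique_def common_def neighbours_def)
  next
    case (Suc j)
    then obtain C where C: "C \<subseteq> V" "clique E C" "v \<in> C" "card C = Suc j"
        "(k - 1 - j) * p < card (common C)"
      by auto
    have split: "k - 1 - j = Suc (k - 1 - Suc j)" using Suc.prems by simp
    have "finite M" using fin \<open>M \<subseteq> V\<close> finite_subset by blast
    \<comment> \<open>More than \<open>p \<ge> card (M - {v})\<close> common neighbours remain, so the clique can be extended
      outside \<open>M\<close>, which costs at most \<open>p\<close> of them.\<close>
    have "\<not> common C \<subseteq> M - {v}"
    proof
      assume "common C \<subseteq> M - {v}"
      then have "card (common C) \<le> card (M - {v})"
        using \<open>finite M\<close> by (intro card_mono) auto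
      also have "\<dots> \<le> p" using \<open>card M \<le> Suc p\<close> \<open>v \<in> M\<close> \<open>finite M\<close> by simp
      finally show False using C(5) split by simp
    qed
    moreover have "v \<notin> common C" using C(3) common_disj[of C] by blast
    ultimately obtain w where w: "w \<in> common C" "w \<notin> M" by blast
    have "w \<in> V" using w common_sub by blast
    have "common C \<subseteq> common (insert w C) \<union> (V - neighbours E V w)"
      by (auto simp: common_def neighbours_def)
    then have "card (common C) \<le> card (common (insert w C) \<union> (V - neighbours E V w))"
      using fin fin_common by (intro card_mono) auto
    also have "\<dots> \<le> card (common (insert w C)) + p"
      using card_Un_le[of "common (insert w C)" "V - neighbours E V w"] nonnb[of w] w \<open>w \<in> V\<close>
      by simp
    finally have "(k - 1 - Suc j) * p < card (common (insert w C))"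
      using C(5) split by simp
    moreover have "clique E (insert w C)"
      using w C(2) by (intro clique_insert) (auto simp: common_def)
    moreover have "card (insert w C) = Suc (Suc j)"
      using w common_disj[of C] C(1,4) fin finite_subset[of C V] by (subst card_insert_disjoint) auto
    ultimately show ?case using \<open>w \<in> V\<close> C by (intro exI[of _ "insert w C"]) auto
  qed
  from step[of "k - 1"] \<open>k > 0\<close> obtain C where
    C: "C \<subseteq> V" "clique E C" "v \<in> C" "card C = k" "card (common C) > 0" by auto
  \<comment> \<open>The last vertex may be any common neighbour, inside \<open>M\<close> or not,
    since no further extension follows.\<close>
  then obtain w where w: "w \<in> common C" by (metis card_gt_0_iff ex_in_conv)
  have "clique E (insert w C)"
    using w C(2) by (intro clique_insert) (auto simp: common_def)
  moreover have "card (insert w C) = Suc k"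
    using w common_disj[of C] C(1,4) fin finite_subset[of C V] by (subst card_insert_disjoint) auto
  moreover have "insert w C \<subseteq> V" using w C(1) common_sub by blast
  ultimately show False
    using avoid \<open>v \<in> M\<close> C(3) unfolding cliques_avoid_def by blast
qed

text \<open>As a function of \<open>card M\<close> the bound decreases as long as \<open>k * card M \<le> card V\<close>, so it may be
  stated for every size of \<open>M\<close>; at \<open>k * card M \<ge> card V\<close> one element of \<open>M\<close> is dropped.\<close>

lemma card_induced_edges_le:
  assumes "finite V" and "\<forall>e\<in>E. card e = 2" and "M \<subseteq> V"
    and "cliques_avoid (Suc k) E V M" and "k > 0"
  shows "2 * int (card (induced_edges E V)) \<le>
    int (card V) * (int (card V) - 1) - 2 * int (card V) * int (card M)
      + int k * int (card M) * (int (card M) + 1)"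
  using assms
proof (induction "card V + card M" arbitrary: V M rule: less_induct)
  case less
  note fin = less.prems(1) and E = less.prems(2)
  have finM: "finite M" using less.prems finite_subset by blast
  show ?case
  proof (cases "M = {}")
    case True
    have "induced_edges E V \<subseteq> {e. e \<subseteq> V \<and> card e = 2}" using E by (auto simp: induced_edges_def)
    then have "card (induced_edges E V) \<le> card V choose 2"
      using fin by (subst n_subsets[symmetric]) (auto intro!: card_mono)
    then have "2 * card (induced_edges E V) \<le> card V * (card V - 1)"
      by (simp add: choose_two)
    then have "int (2 * card (induced_edges E V)) \<le> int (card V * (card V - 1))"
      by (simp only: of_nat_le_iff)
    then show ?thesis using True by (cases "card V") (auto simp: algebra_simps)
  next
    case False
    then obtain v where v: "v \<in> M" by blast
    then have cM: "card M > 0" using finM card_gt_0_iff by blast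
    have cMv: "int (card (M - {v})) = int (card M) - 1" using v finM cM by simp
    show ?thesis
    proof (cases "card V \<le> k * card M")
      case True
      have "2 * int (card (induced_edges E V)) \<le>
        int (card V) * (int (card V) - 1) - 2 * int (card V) * int (card (M - {v}))
        + int k * int (card (M - {v})) * (int (card (M - {v})) + 1)"
        using less.prems v cM finM
        by (intro less.hyps) (auto intro: cliques_avoid_mono)
      moreover have "int (card V) \<le> int k * int (card M)"
        using True by (metis of_nat_le_iff of_nat_mult)
      \<comment> \<open>The bound for \<open>M\<close> exceeds the one for \<open>M - {v}\<close> by
        \<open>2 * (k * card M - card V)\<close>, which is nonnegative in this case.\<close>
      ultimately show ?thesis unfolding cMv by (simp add: algebra_simps)
    next
      case big: False
      \<comment> \<open>If \<open>x \<notin> M\<close> then \<open>M - {x} = M\<close>, so this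
        inequality serves both kinds of deletion.\<close>
      have remove: "2 * int (card (induced_edges E V)) \<le>
          (int (card V) - 1) * (int (card V) - 2) - 2 * (int (card V) - 1) * int (card (M - {x}))
          + int k * int (card (M - {x})) * (int (card (M - {x})) + 1)
          + 2 * int (card (neighbours E V x))" if "x \<in> V" for x
      proof -
        have cV: "card V > 0" using that fin card_gt_0_iff by blast
        have "2 * int (card (induced_edges E (V - {x}))) \<le>
          int (card (V - {x})) * (int (card (V - {x})) - 1)
          - 2 * int (card (V - {x})) * int (card (M - {x}))
          + int k * int (card (M - {x})) * (int (card (M - {x})) + 1)"
          using less.prems that fin finM cV card_mono[of M "M - {x}"]
          by (intro less.hyps) (auto intro: cliques_avoid_mono)
        moreover have "int (card (V - {x})) = int (card V) - 1" using that fin cV by simp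
        ultimately show ?thesis
          using card_induced_edges_remove[OF fin E that] by simp
      qed
      show ?thesis
      proof (cases "\<exists>w\<in>V - M. card (V - neighbours E V w) > card M")
        case True
        then obtain w where w: "w \<in> V" "w \<notin> M" "card (V - neighbours E V w) > card M" by blast
        have "card (neighbours E V w) + card (V - neighbours E V w) = card V"
          using fin neighbours_subset[of E V w]
          by (metis card_Diff_subset card_mono finite_subset le_add_diff_inverse)
        then have "int (card (neighbours E V w)) \<le> int (card V) - int (card M) - 1"
          using w(3) by linarith
        \<comment> \<open>Twice this degree bound is exactly the loss in the right-hand side when
          \<open>card V\<close> drops by one and \<open>M\<close> is unchanged.\<close>
        then show ?thesis using remove[OF w(1)] w(2) by (simp add: algebra_simps)
      next
        case False
        then have "card (neighbours E V v) \<le> (k - 1) * card M"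
          using less.prems v by (intro card_neighbours_le_of_cliques_avoid) (auto simp: not_less)
        then have "int (card (neighbours E V v)) \<le> (int k - 1) * int (card M)"
          using less.prems(5) by (metis One_nat_def Suc_leI of_nat_1 of_nat_diff of_nat_le_iff of_nat_mult)
        moreover have "v \<in> V" using v less.prems by blast
        \<comment> \<open>Again twice the degree bound is exactly the loss, now with both
          \<open>card V\<close> and \<open>card M\<close> lower by one.\<close>
        ultimately show ?thesis using remove[of v] unfolding cMv by (simp add: algebra_simps)
      qed
    qed
  qed
qed

section \<open>Recursion and closed form for Turan numbers\<close>

lemma card_residue_class:
  fixes j k n :: nat
  assumes "j < k"
  shows "card {i. i < n \<and> i mod k = j} = n div k + (if j < n mod k then 1 else 0)"
proof (induction n)
  case (Suc n)
  have "{i. i < Suc n \<and> i mod k = j} =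
      {i. i < n \<and> i mod k = j} \<union> (if n mod k = j then {n} else {})"
    by (auto simp: less_Suc_eq)
  then have "card {i. i < Suc n \<and> i mod k = j} =
      card {i. i < n \<and> i mod k = j} + (if n mod k = j then 1 else 0)"
    by simp
  then show ?case using Suc assms by (auto simp: mod_Suc div_Suc)
qed simp

lemma turan_graph_edge_iff:
  assumes "r \<ge> 2"
  shows "{u, v} \<in> edges (turan_graph r n) \<longleftrightarrow> u < n \<and> v < n \<and> u mod (r - 1) \<noteq> v mod (r - 1)"
  using assms
  by (auto simp: turan_graph_def complete_multipartite_def turan_part_def doubleton_eq_iff)

lemma turan_graph_edge_card:
  "\<forall>e\<in>edges (turan_graph r n). card e = 2"
  by (auto simp: turan_graph_def complete_multipartite_def turan_part_def card_2_iff)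

lemma turan_graph_edge_subset: "e \<in> edges (turan_graph r n) \<Longrightarrow> e \<subseteq> {..<n}"
  by (auto simp: turan_graph_def complete_multipartite_def turan_part_def)

text \<open>The new vertex \<open>n\<close> is joined to every smaller vertex outside its own
  residue class, and exactly \<open>n div k\<close> smaller vertices share its residue.\<close>

lemma turan_number_Suc:
  assumes "k > 0"
  shows "turan_number (Suc k) (Suc n) = turan_number (Suc k) n + (n - n div k)"
proof -
  let ?E = "edges (turan_graph (Suc k) (Suc n))"
  have r: "Suc k \<ge> 2" using assms by simp
  have mem: "e \<in> edges (turan_graph (Suc k) n) \<longleftrightarrow> e \<in> ?E \<and> e \<subseteq> {..<n}" for e
  proof (cases "card e = 2")
    case True
    then obtain a b where "e = {a, b}" by (auto simp: card_2_iff)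
    then show ?thesis by (auto simp: turan_graph_edge_iff[OF r])
  qed (use turan_graph_edge_card in blast)
  have 1: "induced_edges ?E {..<Suc n} = ?E"
    using turan_graph_edge_subset by (auto simp: induced_edges_def)
  have 2: "induced_edges ?E ({..<Suc n} - {n}) = edges (turan_graph (Suc k) n)"
    using mem by (auto simp: induced_edges_def lessThan_Suc)
  have "neighbours ?E {..<Suc n} n = {..<n} - {i. i < n \<and> i mod k = n mod k}"
    by (auto simp: neighbours_def turan_graph_edge_iff[OF r] less_Suc_eq)
  then have "card (neighbours ?E {..<Suc n} n) = n - n div k"
    using card_residue_class[of "n mod k" k n] assms
    by (simp add: card_Diff_subset subset_iff)
  then show ?thesis
    using card_induced_edges_remove[of "{..<Suc n}" ?E n] turan_graph_edge_card
    unfolding turan_number_def num_edges_def by (simp add: 1 2[simplified])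
qed

text \<open>For \<open>k * p \<le> n < k * Suc p\<close> the next vertex adds \<open>n - p\<close>
  edges, half the increment of the right-hand side. At a multiple of \<open>k\<close> the formulas
  for two consecutive values of \<open>p\<close> agree, so the ranges may share end points. The
  formula is the bound of \<open>card_induced_edges_le\<close> at \<open>card M = p\<close>.\<close>

lemma turan_number_closed_form:
  assumes "k > 0" and "k * p \<le> n" and "n \<le> k * Suc p"
  shows "2 * int (turan_number (Suc k) n) =
    int n * (int n - 1) - 2 * int n * int p + int k * int p * (int p + 1)"
  using assms
proof (induction n arbitrary: p)
  case 0
  then have "edges (turan_graph (Suc k) 0) = {}"
    by (auto simp: turan_graph_def complete_multipartite_def turan_part_def)
  then show ?case using 0 by (simp add: turan_number_def num_edges_def)
next
  case (Suc n)
  have main: "2 * int (turan_number (Suc k) (Suc n)) =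
      int (Suc n) * (int (Suc n) - 1) - 2 * int (Suc n) * int p + int k * int p * (int p + 1)"
    if "k * p \<le> n" "n < k * Suc p" for p
  proof -
    have "n div k = p" using that by (intro div_nat_eqI) (auto simp: mult.commute)
    moreover have "n div k \<le> n" by simp
    ultimately have "int (turan_number (Suc k) (Suc n)) =
        int (turan_number (Suc k) n) + int n - int p"
      using turan_number_Suc[OF \<open>k > 0\<close>, of n] by (simp add: of_nat_diff)
    then show ?thesis using Suc.IH[of p] that \<open>k > 0\<close> by (simp add: algebra_simps)
  qed
  show ?case
  proof (cases "k * p = Suc n")
    case True
    \<comment> \<open>Here \<open>n\<close> is still in the range of the predecessor
      \<open>p'\<close>, so the step is made with \<open>p'\<close> and the result rewritten for
      \<open>p\<close>.\<close>
    then obtain p' where p': "p = Suc p'" by (cases p) auto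
    have "int (Suc n) = int k * (int p' + 1)"
      using True p' by (metis of_nat_Suc of_nat_mult add.commute)
    moreover have "2 * int (turan_number (Suc k) (Suc n)) =
      int (Suc n) * (int (Suc n) - 1) - 2 * int (Suc n) * int p' + int k * int p' * (int p' + 1)"
      using True p' \<open>k > 0\<close> by (intro main) (cases k; simp)+
    ultimately show ?thesis unfolding p' by (simp add: algebra_simps)
  next
    case False
    then show ?thesis using Suc.prems by (intro main) auto
  qed
qed

section \<open>Turan graphs as labellings by residues\<close>

text \<open>Exchange the residues \<open>i\<close> and \<open>j\<close> inside each block of
  \<open>k\<close> numbers and keep the quotient. Equal class sizes mean that the incomplete last
  block contains both residues or neither, so the map stays below \<open>n\<close>.\<close>

lemma swap_residues:
  fixes k n i j :: nat
  assumes "i < k" "j < k" "card {u. u < n \<and> u mod k = i} = card {u. u < n \<and> u mod k = j}"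
  shows "\<exists>g. bij_betw g {..<n} {..<n} \<and> (\<forall>u<n. g u mod k = transpose i j (u mod k))"
proof -
  define t where "t = transpose i j"
  define g where "g u = u div k * k + t (u mod k)" for u
  have t_less: "t a < k" if "a < k" for a using that assms by (auto simp: t_def transpose_def)
  have g_mod: "g u mod k = t (u mod k)" and g_div: "g u div k = u div k" for u
    using t_less[of "u mod k"] assms by (auto simp: g_def)
  have g_g: "g (g u) = u" for u
    by (simp add: g_def[of "g u"] g_mod g_div) (simp add: t_def)
  have iff: "i < n mod k \<longleftrightarrow> j < n mod k"
    using assms card_residue_class[of i k n] card_residue_class[of j k n] by (auto split: if_splits)
  \<comment> \<open>The order on numbers is the lexicographic order on quotient and remainder;
    \<open>g\<close> keeps the first and respects the cut-off \<open>n mod k\<close> on the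
    second.\<close>
  have less_iff: "u < n \<longleftrightarrow> u div k < n div k \<or> u div k = n div k \<and> u mod k < n mod k" for u
  proof -
    consider "u div k < n div k" | "u div k = n div k" | "n div k < u div k" by linarith
    then show ?thesis
    proof cases
      case 1
      then have "u < n" using div_le_mono[of n u k] by (meson not_le)
      then show ?thesis using 1 by simp
    next
      case 3
      then have "\<not> u < n" using div_le_mono[of u n k] by (meson not_le less_imp_le)
      then show ?thesis using 3 by simp
    next
      case 2
      have "u = u div k * k + u mod k" "n = n div k * k + n mod k" by simp_all
      then have "u < n \<longleftrightarrow> u mod k < n mod k" unfolding 2 by linarith
      then show ?thesis using 2 by simp
    qed
  qed
  have "g u < n" if "u < n" for u
  proof -
    have "t a < n mod k \<longleftrightarrow> a < n mod k" for a using iff by (simp add: t_def transpose_def)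
    then have "g u < n \<longleftrightarrow> u < n"
      by (simp only: less_iff[of "g u"] less_iff[of u] g_mod g_div)
    then show ?thesis using that by simp
  qed
  then have "bij_betw g {..<n} {..<n}"
    by (intro bij_betw_byWitness[where f' = g]) (auto simp: g_g)
  then show ?thesis using g_mod by (auto simp: t_def)
qed

text \<open>For \<open>k > 0\<close> this is an isomorphism from the graph induced on
  \<open>V\<close> to the Turan graph with \<open>k\<close> parts, where \<open>f u mod k\<close> is
  the part of \<open>u\<close>. Bijectivity onto an initial segment makes the parts
  balanced.\<close>

definition turan_colouring :: "nat \<Rightarrow> 'a set set \<Rightarrow> 'a set \<Rightarrow> ('a \<Rightarrow> nat) \<Rightarrow> bool" where
  "turan_colouring k E V f \<longleftrightarrow>
     bij_betw f V {..<card V} \<and> (\<forall>u\<in>V. \<forall>v\<in>V. {u, v} \<in> E \<longleftrightarrow> f u mod k \<noteq> f v mod k)"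

lemma card_colour_class:
  assumes "turan_colouring k E V f"
  shows "card {u \<in> V. f u mod k = j} = card {i. i < card V \<and> i mod k = j}"
proof (rule bij_betw_same_card)
  have "bij_betw f V {..<card V}" using assms by (simp add: turan_colouring_def)
  then have "inj_on f V" and image: "f ` V = {..<card V}" by (simp_all add: bij_betw_def)
  show "bij_betw f {u \<in> V. f u mod k = j} {i. i < card V \<and> i mod k = j}"
  proof (rule bij_betw_imageI)
    show "inj_on f {u \<in> V. f u mod k = j}"
      using \<open>inj_on f V\<close> by (rule inj_on_subset) simp
    have "f ` {u \<in> V. f u mod k = j} = {i. i \<in> f ` V \<and> i mod k = j}" by blast
    also have "\<dots> = {i. i < card V \<and> i mod k = j}" by (simp only: image lessThan_iff)
    finally show "f ` {u \<in> V. f u mod k = j} = {i. i < card V \<and> i mod k = j}" .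
  qed
qed

text \<open>Parts of equal size are interchangeable: compose \<open>f\<close> with the map from
  \<open>swap_residues\<close>. This moves a smallest part to the residue of the next free
  label.\<close>

lemma turan_colouring_swap:
  assumes f: "turan_colouring k E V f" and "i < k" "j < k"
    and "card {u \<in> V. f u mod k = i} = card {u \<in> V. f u mod k = j}"
  shows "\<exists>g. turan_colouring k E V g \<and> (\<forall>u\<in>V. g u mod k = transpose i j (f u mod k))"
proof -
  obtain h where h: "bij_betw h {..<card V} {..<card V}"
      "\<forall>u<card V. h u mod k = transpose i j (u mod k)"
    using swap_residues[of i k j "card V"] assms card_colour_class[OF f] by auto
  have bij: "bij_betw f V {..<card V}" using f by (simp add: turan_colouring_def)
  then have "f u < card V" if "u \<in> V" for u using that bij_betwE by blast
  then have col: "\<forall>u\<in>V. (h \<circ> f) u mod k = transpose i j (f u mod k)" using h by simp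
  moreover have "transpose i j a = transpose i j b \<longleftrightarrow> a = b" for a b
    by (metis transpose_involutory)
  moreover have "bij_betw (h \<circ> f) V {..<card V}" using bij h(1) by (rule bij_betw_trans)
  ultimately have "turan_colouring k E V (h \<circ> f)"
    using f unfolding turan_colouring_def by (simp del: comp_apply)
  then show ?thesis using col by blast
qed

text \<open>The new vertex takes the next free label \<open>card (V - {x})\<close>;
  \<open>nonnb\<close> says that \<open>x\<close> misses exactly the part of that label.\<close>

lemma turan_colouring_extend:
  assumes "finite V" and "\<forall>e\<in>E. card e = 2" and "x \<in> V"
    and f: "turan_colouring k E (V - {x}) f"
    and nonnb: "\<And>u. u \<in> V - {x} \<Longrightarrow> {u, x} \<in> E \<longleftrightarrow> f u mod k \<noteq> card (V - {x}) mod k"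
  shows "turan_colouring k E V (f(x := card (V - {x})))"
proof -
  let ?n = "card (V - {x})"
  have cV: "card V = Suc ?n" using assms(1,3) by (metis card_Suc_Diff1)
  have "bij_betw (f(x := ?n)) (V - {x}) {..<?n}"
    using f unfolding turan_colouring_def by (subst bij_betw_cong[of _ _ f]) auto
  then have "bij_betw (f(x := ?n)) (V - {x} \<union> {x}) ({..<?n} \<union> {(f(x := ?n)) x})"
    by (subst notIn_Un_bij_betw3[symmetric]) auto
  moreover have "V - {x} \<union> {x} = V" using assms(3) by blast
  moreover have "{..<?n} \<union> {(f(x := ?n)) x} = {..<card V}" unfolding cV by auto
  moreover have "{u, v} \<in> E \<longleftrightarrow> (f(x := ?n)) u mod k \<noteq> (f(x := ?n)) v mod k"
    if "u \<in> V" "v \<in> V" for u v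
  proof -
    have "{x} \<notin> E" using assms(2) by force
    moreover have "{u, v} \<in> E \<longleftrightarrow> f u mod k \<noteq> f v mod k" if "u \<noteq> x" "v \<noteq> x"
      using f that \<open>u \<in> V\<close> \<open>v \<in> V\<close> unfolding turan_colouring_def by blast
    ultimately show ?thesis
      using nonnb[of u] nonnb[of v] that by (auto simp: insert_commute)
  qed
  ultimately show ?thesis unfolding turan_colouring_def by metis
qed

text \<open>If \<open>x\<close> had a neighbour in every part, one neighbour from each part together
  with \<open>x\<close> would form a clique of size \<open>Suc k\<close>.\<close>

lemma colour_class_without_neighbours:
  assumes "finite V" and E: "\<forall>e\<in>E. card e = 2" and "x \<in> V" and "M \<subseteq> V"
    and avoid: "cliques_avoid (Suc k) E V M" and "k > 0"
    and f: "turan_colouring k E (V - {x}) f"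
    and "v \<in> M" and v: "v = x \<or> {v, x} \<in> E"
  shows "\<exists>j<k. \<forall>u\<in>V - {x}. f u mod k = j \<longrightarrow> {u, x} \<notin> E"
proof (rule ccontr)
  assume "\<not> ?thesis"
  then have "\<forall>j\<in>{..<k}. \<exists>u. u \<in> V - {x} \<and> f u mod k = j \<and> {u, x} \<in> E"
    by (metis lessThan_iff)
  then obtain g where g: "\<forall>j\<in>{..<k}. g j \<in> V - {x} \<and> f (g j) mod k = j \<and> {g j, x} \<in> E"
    by metis
  \<comment> \<open>Choosing \<open>v\<close> itself as the representative of its own part, unless
    \<open>v = x\<close>, forces the clique to meet \<open>M\<close>.\<close>
  define h where "h j = (if v \<noteq> x \<and> j = f v mod k then v else g j)" for j
  have h: "h j \<in> V - {x}" "f (h j) mod k = j" "{h j, x} \<in> E" if "j < k" for j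
    using g that v \<open>v \<in> M\<close> \<open>M \<subseteq> V\<close> by (auto simp: h_def)
  let ?C = "insert x (h ` {..<k})"
  have "inj_on h {..<k}" by (rule inj_onI) (metis h(2) lessThan_iff)
  then have "card ?C = Suc k"
    using h(1) by (subst card_insert_disjoint) (auto simp: card_image)
  moreover have "clique E (h ` {..<k})"
    using f h by (auto simp: clique_def turan_colouring_def)
  then have "clique E ?C"
    using h(3) by (intro clique_insert) (auto simp: insert_commute)
  moreover have "?C \<subseteq> V" using h(1) \<open>x \<in> V\<close> by auto
  moreover have "v \<in> ?C"
  proof (cases "v = x")
    case False
    then have "h (f v mod k) = v" by (simp add: h_def)
    moreover have "f v mod k < k" using \<open>k > 0\<close> by simp
    ultimately show ?thesis by (metis imageI insertCI lessThan_iff)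
  qed simp
  ultimately show False using avoid \<open>v \<in> M\<close> unfolding cliques_avoid_def by blast
qed

section \<open>Turan bound and uniqueness of the extremal graph\<close>

lemma card_induced_edges_le_turan_number:
  assumes "finite V" and "\<forall>e\<in>E. card e = 2" and "M \<subseteq> V"
    and "cliques_avoid (Suc k) E V M" and "k > 0"
    and "p \<le> card M" and "k * p \<le> card V" and "card V \<le> k * Suc p"
  shows "card (induced_edges E V) \<le> turan_number (Suc k) (card V)"
proof -
  obtain M' where M': "M' \<subseteq> M" "card M' = p"
    using obtain_subset_with_card_n[OF \<open>p \<le> card M\<close>] by blast
  have "2 * int (card (induced_edges E V)) \<le> 2 * int (turan_number (Suc k) (card V))"
    unfolding turan_number_closed_form[OF assms(5,7,8)] M'(2)[symmetric]
    using assms M' by (intro card_induced_edges_le) (auto intro: cliques_avoid_mono)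
  then show ?thesis by simp
qed

text \<open>By the edge bound after deletion, every vertex of an extremal graph has degree at least
  the increment of the Turan number. A vertex attaining this minimum can be deleted, and what is
  left is extremal again.\<close>

lemma turan_colouring_exists:
  assumes "finite V" and "\<forall>e\<in>E. card e = 2" and "M \<subseteq> V"
    and "cliques_avoid (Suc k) E V M" and "k > 0"
    and "card V \<le> k * card M"
    and "turan_number (Suc k) (card V) \<le> card (induced_edges E V)"
  shows "\<exists>f. turan_colouring k E V f"
  using assms
proof (induction "card V" arbitrary: V M)
  case 0
  then show ?case by (auto simp: turan_colouring_def bij_betw_def)
next
  case (Suc n)
  note fin = \<open>finite V\<close> and E = \<open>\<forall>e\<in>E. card e = 2\<close> and k = \<open>k > 0\<close>
  define p where "p = n div k"
  have p: "k * p \<le> n" "n < k * Suc p"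
    using k by (auto simp: p_def dividend_less_times_div mult.commute add.commute)
  have "p < card M" using Suc.prems(6) Suc.hyps(2) k by (simp add: p_def div_less_iff_less_mult mult.commute)
  then obtain M' where M': "M' \<subseteq> M" "card M' = Suc p"
    using obtain_subset_with_card_n[of "Suc p" M] by auto
  have M'V: "M' \<subseteq> V" using M' Suc.prems(3) by blast
  have finM': "finite M'" using M'V fin finite_subset by blast
  have avoid: "cliques_avoid (Suc k) E V M'" using Suc.prems(4) M' cliques_avoid_mono by blast
  have card_remove: "card (V - {x}) = n" if "x \<in> V" for x using that fin Suc.hyps(2) by simp
  have T: "turan_number (Suc k) (Suc n) = turan_number (Suc k) n + (n - p)"
    using turan_number_Suc[OF k] by (simp add: p_def)
  have edges_remove: "card (induced_edges E (V - {x})) \<le> turan_number (Suc k) n" if "x \<in> V" for x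
  proof -
    have "p \<le> card (M' - {x})" using M'(2) by (cases "x \<in> M'") auto
    then show ?thesis
      unfolding card_remove[OF that, symmetric]
      using fin E M'V avoid k p card_remove[OF that]
      by (intro card_induced_edges_le_turan_number[of _ E "M' - {x}" k p])
        (auto intro: cliques_avoid_mono)
  qed
  have deg_ge: "n - p \<le> card (neighbours E V x)" if "x \<in> V" for x
    using edges_remove[OF that] T Suc.prems(7) Suc.hyps(2)
      card_induced_edges_remove[OF fin E that] by simp
  have split_deg: "card (neighbours E V x) + card (V - neighbours E V x) = Suc n" for x
    using fin Suc.hyps(2) neighbours_subset[of E V x]
    by (metis card_Diff_subset card_mono finite_subset le_add_diff_inverse)
  have "p \<le> n" by (simp add: p_def)
  \<comment> \<open>If the deleted vertex has to come from \<open>M'\<close>, its small degree forces \<open>n = k * p\<close>, so that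
    the \<open>p\<close> remaining elements of \<open>M'\<close> suffice for the induction hypothesis.\<close>
  obtain x where x: "x \<in> V" "card (neighbours E V x) \<le> n - p" "n \<le> k * card (M' - {x})"
  proof (cases "\<exists>w\<in>V - M'. card (V - neighbours E V w) > p")
    case True
    then obtain w where w: "w \<in> V" "w \<notin> M'" "card (V - neighbours E V w) > p" by blast
    show ?thesis
      using w split_deg[of w] M'(2) p by (intro that[of w]) auto
  next
    case False
    obtain v where v: "v \<in> M'" using M'(2) by fastforce
    have deg: "card (neighbours E V v) \<le> (k - 1) * p"
      using False fin E M'V avoid k M'(2) v
      by (intro card_neighbours_le_of_cliques_avoid) (auto simp: not_less)
    moreover have "n - p \<le> card (neighbours E V v)" using deg_ge v M'V by blast
    moreover have "(k - 1) * p + p = k * p" using k by (cases k) auto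
    ultimately have "n = k * p" using p(1) \<open>p \<le> n\<close> by linarith
    then show ?thesis
      using v M'V M'(2) finM' deg \<open>(k - 1) * p + p = k * p\<close> by (intro that[of v]) auto
  qed
  have deg: "card (neighbours E V x) = n - p" using x deg_ge[of x] by simp
  have "turan_number (Suc k) n \<le> card (induced_edges E (V - {x}))"
    using T Suc.prems(7) Suc.hyps(2) card_induced_edges_remove[OF fin E x(1)] deg by simp
  then obtain f where f: "turan_colouring k E (V - {x}) f"
    using Suc.hyps(1)[of "V - {x}" "M' - {x}"] fin E M'V avoid k x(3) card_remove[OF x(1)]
    by (auto intro: cliques_avoid_mono)
  \<comment> \<open>The non-neighbours of \<open>x\<close> other than \<open>x\<close> itself; there
    are exactly \<open>p\<close> of them.\<close>
  define N where "N = V - {x} - neighbours E V x"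
  have "V - neighbours E V x = insert x N"
    using x(1) not_self_neighbour[OF E] by (auto simp: N_def)
  then have cN: "card N = p"
    using split_deg[of x] deg fin \<open>p \<le> n\<close> by (simp add: N_def)
  have finN: "finite N" using fin by (simp add: N_def)
  \<comment> \<open>Since \<open>M'\<close> has \<open>p + 1\<close> elements, one of them is
    \<open>x\<close> or adjacent to \<open>x\<close>, as the clique argument requires.\<close>
  have "\<not> M' \<subseteq> N" using card_mono[OF finN, of M'] cN M'(2) by auto
  then obtain v where v: "v \<in> M'" "v \<notin> N" by blast
  then have "v = x \<or> {v, x} \<in> E" using M'V by (auto simp: N_def neighbours_def)
  then obtain j where j: "j < k" "\<forall>u\<in>V - {x}. f u mod k = j \<longrightarrow> {u, x} \<notin> E"
    using colour_class_without_neighbours[OF fin E x(1) M'V avoid k f v(1)] by blast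
  have sub: "{u \<in> V - {x}. f u mod k = j} \<subseteq> N" using j by (auto simp: N_def neighbours_def)
  have size: "card {u \<in> V - {x}. f u mod k = i} = p + (if i < n mod k then 1 else 0)" if "i < k" for i
    using card_colour_class[OF f, of i] card_residue_class[OF that, of n] card_remove[OF x(1)]
    by (simp add: p_def)
  \<comment> \<open>Every part has at least \<open>p\<close> elements and \<open>N\<close> has only
    \<open>p\<close>, so the missed part is all of \<open>N\<close>.\<close>
  have eq: "{u \<in> V - {x}. f u mod k = j} = N"
    using sub size[OF j(1)] cN by (intro card_subset_eq[OF finN]) (use card_mono[OF finN sub] in auto)
  \<comment> \<open>The residue \<open>n mod k\<close> is not below itself, so its part also has the
    minimal size \<open>p\<close>. This is the part that the next label \<open>n\<close>
    joins.\<close>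
  have "card {u \<in> V - {x}. f u mod k = j} = card {u \<in> V - {x}. f u mod k = n mod k}"
    using size[of "n mod k"] k unfolding eq cN by simp
  then obtain g where g: "turan_colouring k E (V - {x}) g"
      "\<forall>u\<in>V - {x}. g u mod k = transpose j (n mod k) (f u mod k)"
    using turan_colouring_swap[OF f j(1), of "n mod k"] k by auto
  have "{u, x} \<in> E \<longleftrightarrow> g u mod k \<noteq> card (V - {x}) mod k" if "u \<in> V - {x}" for u
  proof -
    have "{u, x} \<in> E \<longleftrightarrow> u \<notin> N" using that by (auto simp: N_def neighbours_def)
    also have "\<dots> \<longleftrightarrow> f u mod k \<noteq> j" using that eq by blast
    also have "\<dots> \<longleftrightarrow> g u mod k \<noteq> n mod k" using g(2) that by (auto simp: transpose_def)
    finally show ?thesis using card_remove[OF x(1)] by simp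
  qed
  then show ?case using turan_colouring_extend[OF fin E x(1) g(1)] by blast
qed

section \<open>Return to graph isomorphisms and copies of complete graphs\<close>

lemma graph_iso_turan_graph:
  assumes "turan_colouring k (edges G) (verts G) f" and "k > 0"
  shows "graph_iso G (turan_graph (Suc k) (card (verts G)))"
proof -
  have bij: "bij_betw f (verts G) {..<card (verts G)}"
    using assms by (simp add: turan_colouring_def)
  then have "f u < card (verts G)" if "u \<in> verts G" for u using that bij_betwE by blast
  then show ?thesis
    using assms bij unfolding graph_iso_def turan_colouring_def
    by (intro exI[of _ f]) (simp add: verts_turan_graph turan_graph_edge_iff)
qed

text \<open>A clique \<open>C\<close> of size \<open>r\<close> carries the subgraph of all its
  pairs, and any bijection from \<open>C\<close> to \<open>{..<r}\<close> makes it a copy of the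
  complete graph.\<close>

lemma cliques_avoid_if_no_copy:
  assumes "finite_simple_graph G"
    and no_copy: "\<not> (\<exists>H. copy_of_complete_graph r G H \<and> verts H \<inter> M \<noteq> {})"
  shows "cliques_avoid r (edges G) (verts G) M"
  unfolding cliques_avoid_def
proof (intro allI impI, elim conjE)
  fix C assume C: "C \<subseteq> verts G" "clique (edges G) C" "card C = r"
  define H where "H = \<lparr>verts = C, edges = {{u, v} |u v. u \<in> C \<and> v \<in> C \<and> u \<noteq> v}\<rparr>"
  have "finite C" using C(1) assms(1) finite_subset by (auto simp: finite_simple_graph_def)
  then obtain f where f: "bij_betw f C {..<r}"
    using C(3) by (metis bij_betw_iff_card card_lessThan finite_lessThan)
  have "subgraph H G"
    using C \<open>finite C\<close>
    by (auto simp: subgraph_def finite_simple_graph_def H_def clique_def card_2_iff)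
  moreover have "f u < r" if "u \<in> C" for u using f that bij_betwE by blast
  moreover have "f u = f v \<longleftrightarrow> u = v" if "u \<in> C" "v \<in> C" for u v
    using f that by (auto simp: bij_betw_def inj_on_def)
  ultimately have "{u, v} \<in> edges H \<longleftrightarrow> {f u, f v} \<in> edges (complete_graph r)"
    if "u \<in> C" "v \<in> C" for u v
    using that by (simp add: H_def complete_graph_def doubleton_eq_iff) metis
  then have "graph_iso H (complete_graph r)"
    using f unfolding graph_iso_def by (intro exI[of _ f]) (simp add: H_def complete_graph_def)
  with \<open>subgraph H G\<close> show "C \<inter> M = {}"
    using no_copy unfolding copy_of_complete_graph_def H_def by force
qed

theorem theorem1p2:
  fixes G :: "'a graph" and M :: "'a set" and r n m :: nat
  assumes "r \<ge> 3" and "m > 0" and "n > 0" and "m \<le> n"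
    and "finite_simple_graph G" and "card (verts G) = n"
    and "M \<subseteq> verts G" and "card M = m"
    and "\<not> (\<exists>H. copy_of_complete_graph r G H \<and> verts H \<inter> M \<noteq> {})"
  shows "int (num_edges G) \<le> turan_bound r n m \<and>
    (n \<le> (r - 1) * m \<and> int (num_edges G) = turan_bound r n m \<longrightarrow>
       graph_iso G (turan_graph r n))"
proof -
  obtain k where r: "r = Suc k" and k: "k > 0" using \<open>r \<ge> 3\<close> by (cases r) auto
  have fin: "finite (verts G)" and E: "\<forall>e\<in>edges G. card e = 2"
    using assms(5) by (auto simp: finite_simple_graph_def)
  have avoid: "cliques_avoid (Suc k) (edges G) (verts G) M"
    using cliques_avoid_if_no_copy[OF assms(5,9)] r by simp
  have ind: "card (induced_edges (edges G) (verts G)) = num_edges G"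
    using assms(5) by (auto simp: induced_edges_def num_edges_def finite_simple_graph_def
        intro: arg_cong[of _ _ card])
  show ?thesis
  proof (cases "n \<le> k * m")
    case True
    \<comment> \<open>This choice gives \<open>p \<le> m\<close> and
      \<open>k * p \<le> n \<le> k * Suc p\<close>, the range in which the closed form
      holds.\<close>
    define p where "p = (n - 1) div k"
    have "n - 1 < k * m" using True \<open>n > 0\<close> by simp
    then have "p \<le> m" using k by (simp add: p_def div_less_iff_less_mult mult.commute less_imp_le)
    moreover have "k * p \<le> n - 1" "n - 1 < k * Suc p"
      using k by (auto simp: p_def dividend_less_times_div mult.commute add.commute)
    ultimately have "num_edges G \<le> turan_number (Suc k) n"
      using card_induced_edges_le_turan_number[OF fin E assms(7) avoid k, of p] assms(6,8) ind
      by auto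
    moreover have "graph_iso G (turan_graph r n)" if "num_edges G = turan_number (Suc k) n"
      using turan_colouring_exists[OF fin E assms(7) avoid k] graph_iso_turan_graph[OF _ k]
        True that ind assms(6,8) r by auto
    ultimately show ?thesis using True r by (auto simp: turan_bound_def)
  next
    case False
    have choose: "2 * int (a choose 2) = int a * (int a - 1)" for a :: nat
    proof -
      have "2 * (a choose 2) = a * (a - 1)"
        unfolding choose_two by (rule dvd_mult_div_cancel) auto
      then have "int (2 * (a choose 2)) = int (a * (a - 1))" by presburger
      then show ?thesis by (cases a) (auto simp: algebra_simps)
    qed
    have "2 * int (num_edges G) \<le>
        int n * (int n - 1) - 2 * int n * int m + int k * int m * (int m + 1)"
      using card_induced_edges_le[OF fin E assms(7) avoid k] assms(6,8) ind by simp
    moreover have "2 * (int k * int ((m + 1) choose 2)) = int k * int m * (int m + 1)"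
      using choose[of "m + 1"] by (simp add: algebra_simps)
    ultimately have "int (num_edges G) \<le>
        int (n choose 2) - int n * int m + int k * int ((m + 1) choose 2)"
      using choose[of n] by linarith
    then show ?thesis using False r by (simp add: turan_bound_def)
  qed
qed

end
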